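(* Let $\Omega$ be as described in the context, $S^0\in\mathcal W$, and let $d\colon\mathcal W\times\mathbb R_+\to\mathcal T_0$ be given by $$d(S,h)=\Pi_0\Big(\Omega S+\frac h2\,\Omega R_S(\Omega S)\Big),\qquad S\in\mathcal W,\ h\in\mathbb R_+ .$$ Then the following holds. (i) There exist sequences $(h_k)_{k\ge0},(\theta_k)_{k\ge0}\subset\mathbb R_+$ and constants $0<c_1<c_2<1$ such that setting $$S^{k+\frac12}=\exp_{S^k}(\theta_k\Omega S^k),\qquad S^{k+1}=\exp_{S^{k+\frac12}}\Big(\frac{h_k\theta_k}{2}\,\Omega R_{S^k}(\Omega S^k)\Big)\tag{$*$}$$ and $d^k:=d(S^k,h_k)\in\mathcal T_0$ yields iterates $S^{k+1}=\exp_{S^k}(\theta_kd^k)$, $k\in\mathbb N$, satisfying $$J(S^{k+1})-J(S^k)\le c_1\theta_k\,\langle\mathrm{grad}_gJ(S^k),R_{S^k}(d^k)\rangle_{S^k}\qquad\text{(Armijo condition)},$$ $$\big|\langle\mathrm{grad}_gJ(S^{k+1}),R_{S^k}(d^k)\rangle_{S^k}\big|\le c_2\,\big|\langle\mathrm{grad}_gJ(S^k),R_{S^k}(d^k)\rangle_{S^k}\big|\qquad\text{(curvature condition)}.$$ (ii) For sequences as in (i), suppose the limit $\gamma_*=\lim_{k\to\infty}\theta_k$ exists and is bounded away from zero, i.e. $\gamma_*>0$. Then any limit point $S^*\in\overline{\mathcal W}$ of the sequence $(S^k)$ from $( * )$ is an equilibrium of the flow $\dot S=R_S(\Omega S)$.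 (iii) If $S^*$ is a limit point of the sequence $( * )$ which locally minimizes $J$, with sequences $(\theta_k)_{k\ge0},(h_k)_{k\ge0}$ as in (ii), then $S^*\in\overline{\mathcal W}\setminus\mathcal W$. (iv) If additionally $\sum_{k\ge0}h_k<\infty$ holds in (ii), then the sequence $(\epsilon_k)_{k\ge0}$ with $\epsilon_k:=\|\mathrm{grad}_gJ(S^k)\|$ is a zero sequence.
   Context: $\mathcal V\subset\mathbb Z^d$ ($d\ge2$) is a finite vertex set, $n=|\mathcal V|$, and $c\ge2$ is the number of labels. $\Omega\in\mathbb R^{\mathcal V\times\mathcal V}$ is of the form $\Omega(x,y)=\Theta(x,y)\alpha^2(x,y)$ for $x\ne y$, $\Omega(x,x)=\Theta(x,x)$, where, with $\mathcal V^{\alpha}_{\mathcal I}=\{x\in\mathbb Z^d\setminus\mathcal V:\alpha(x,y)\neq0\text{ for some }y\in\mathcal V\}$ and $\overline{\mathcal V}=\mathcal V\,\dot\cup\,\mathcal V^{\alpha}_{\mathcal I}$ (finite), $\alpha\colon\overline{\mathcal V}\times\overline{\mathcal V}\to\mathbb R$ is antisymmetric with $\alpha=0$ on $\mathcal V^{\alpha}_{\mathcal I}\times\mathcal V^{\alpha}_{\mathcal I}$ and $\Theta\colon\overline{\mathcal V}\times\overline{\mathcal V}\to\mathbb R$ is symmetric and nonnegative. In particular $\Omega$ is symmetric and nonnegative; standing assumption on the weights: $0\le\Omega(x,y)\le1$ and $\sum_{y\in\mathcal V}\Omega(x,y)=1$ for all $x\in\mathcal V$. $\mathcal S$ is the relative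 interior of the probability simplex $\Delta_c\subset\mathbb R^c$; $\mathcal W$ is the set of $n\times c$ matrices $S$ with rows $S(x)\in\mathcal S$, $x\in\mathcal V$; $\overline{\mathcal W}$ its closure (rows in $\Delta_c$). $T_0=\{v\in\mathbb R^c:\langle\mathbb 1_c,v\rangle=0\}$, and $\mathcal T_0$ is the space of $n\times c$ matrices with rows in $T_0$; $\Pi_0$ is the row-wise orthogonal projection $u\mapsto u-\frac1c\langle\mathbb 1_c,u\rangle\mathbb 1_c$ onto it. $R_p=\mathrm{Diag}(p)-pp^\top$, applied row-wise: $(R_SV)(x)=R_{S(x)}V(x)$. $\exp_p(v)=\frac{p\odot e^v}{\langle p,e^v\rangle}$ (componentwise operations, $v\in\mathbb R^c$), applied row-wise. $\Omega S$ is the matrix product. $\langle U,V\rangle_S=\sum_{x\in\mathcal V}\sum_{j=1}^c\frac{U_j(x)V_j(x)}{S_j(x)}$ for $U,V\in\mathcal T_0$ is the Fisher-Rao metric. $J(S)=-\frac12\langle S,\Omega S\rangle$ (Frobenius inner product), with Riemannian gradient $\mathrm{grad}_gJ(S)=-R_S(\Omega S)$. $S^*\in\overline{\mathcal W}$ is an equilibrium of the flow $\dot S=R_S(\Omega S)$ if $R_{S^*}(\Omega S^* )=0$. $\|\cdot\|$ is the Euclidean (Frobenius) norm.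
   Formalization: Part (ii) additionally assumes sufficient descent: for some σ>0 and all large k, ⟨grad J(S^k),R_{S^k}d^k⟩_{S^k} ≤ −σ‖grad J(S^k)‖²_{S^k}; without it large h_k can give d^k=0 at a non-equilibrium. Part (i) also yields this; (iii),(iv) do not assume it. *)

theory Defs
  imports "HOL-Analysis.Analysis"
begin

text \<open>
  The \<open>n\<close>-element vertex set \<open>V\<close> in \<open>\<int>\<^sup>d\<close> is enumerated by a finite index type \<open>'n\<close> through an
  injective map \<open>pos :: 'n \<Rightarrow> int ^ 'd\<close> with \<open>V = range pos\<close>, and labels are indexed by \<open>'c\<close>.
  A matrix with rows \<open>S(x)\<close>, \<open>x \<in> V\<close>, is then an element of \<open>real ^ 'c ^ 'n\<close>, whose library
  inner product and norm are the Frobenius ones and on which \<open>\<Omega> ** S\<close> is the matrix product.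
\<close>

section \<open>Nonlocal weights\<close>

text \<open>The functions \<open>\<alpha>\<close> and \<open>\<Theta>\<close> are total; only their values on the extended vertex set matter,
  apart from \<open>\<alpha>\<close> determining the interaction domain itself.\<close>

definition interaction_domain :: "('v \<Rightarrow> 'v \<Rightarrow> real) \<Rightarrow> 'v set \<Rightarrow> 'v set" where
  "interaction_domain \<alpha> V = {x. x \<notin> V \<and> (\<exists>y\<in>V. \<alpha> x y \<noteq> 0)}"

definition extended_vertices :: "('v \<Rightarrow> 'v \<Rightarrow> real) \<Rightarrow> 'v set \<Rightarrow> 'v set" where
  "extended_vertices \<alpha> V = V \<union> interaction_domain \<alpha> V"

definition nonlocal_weights ::
    "('n::finite \<Rightarrow> 'v) \<Rightarrow> ('v \<Rightarrow> 'v \<Rightarrow> real) \<Rightarrow> ('v \<Rightarrow> 'v \<Rightarrow> real) \<Rightarrow> real ^ 'n ^ 'n" where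
  "nonlocal_weights pos \<Theta> \<alpha> =
     (\<chi> i j. if i = j then \<Theta> (pos i) (pos i) else \<Theta> (pos i) (pos j) * (\<alpha> (pos i) (pos j))\<^sup>2)"

section \<open>Assignment manifold\<close>

definition prob_simplex :: "(real ^ 'c::finite) set" where
  "prob_simplex = {p. (\<forall>j. 0 \<le> p $ j) \<and> (\<Sum>j\<in>UNIV. p $ j) = 1}"

definition assignment_manifold :: "(real ^ 'c::finite ^ 'n::finite) set" where
  "assignment_manifold = {S. \<forall>x. S $ x \<in> rel_interior prob_simplex}"

definition tangent_space :: "(real ^ 'c::finite ^ 'n::finite) set" where
  "tangent_space = {V. \<forall>x. 1 \<bullet> (V $ x) = 0}"

definition tangent_proj :: "real ^ 'c::finite ^ 'n::finite \<Rightarrow> real ^ 'c ^ 'n" where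
  "tangent_proj V = (\<chi> x. V $ x - ((1 \<bullet> (V $ x)) / real CARD('c)) *\<^sub>R 1)"

text \<open>The matrix \<open>R\<^sub>p = Diag(p) - p p\<^sup>T\<close>.\<close>

definition replicator_matrix :: "real ^ 'c::finite \<Rightarrow> real ^ 'c ^ 'c" where
  "replicator_matrix p = (\<chi> i j. (if i = j then p $ i else 0) - p $ i * p $ j)"

definition replicator ::
    "real ^ 'c::finite ^ 'n::finite \<Rightarrow> real ^ 'c ^ 'n \<Rightarrow> real ^ 'c ^ 'n" where
  "replicator S V = (\<chi> x. replicator_matrix (S $ x) *v (V $ x))"

definition lifting :: "real ^ 'c::finite \<Rightarrow> real ^ 'c \<Rightarrow> real ^ 'c" where
  "lifting p v = (\<chi> j. p $ j * exp (v $ j) / (\<Sum>i\<in>UNIV. p $ i * exp (v $ i)))"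

definition liftings ::
    "real ^ 'c::finite ^ 'n::finite \<Rightarrow> real ^ 'c ^ 'n \<Rightarrow> real ^ 'c ^ 'n" where
  "liftings S V = (\<chi> x. lifting (S $ x) (V $ x))"

definition fisher_rao ::
    "real ^ 'c::finite ^ 'n::finite \<Rightarrow> real ^ 'c ^ 'n \<Rightarrow> real ^ 'c ^ 'n \<Rightarrow> real" where
  "fisher_rao S U V = (\<Sum>x\<in>UNIV. \<Sum>j\<in>UNIV. U $ x $ j * V $ x $ j / S $ x $ j)"

section \<open>Objective and flow\<close>

definition objective :: "real ^ 'n::finite ^ 'n \<Rightarrow> real ^ 'c::finite ^ 'n \<Rightarrow> real" where
  "objective \<Omega> S = - (1 / 2) * (S \<bullet> (\<Omega> ** S))"

text \<open>For symmetric \<open>\<Omega>\<close> this is the gradient of the objective with respect to the Fisher-Rao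
  metric, see \<open>riemannian_gradient\<close> below.\<close>

definition grad_objective ::
    "real ^ 'n::finite ^ 'n \<Rightarrow> real ^ 'c::finite ^ 'n \<Rightarrow> real ^ 'c ^ 'n" where
  "grad_objective \<Omega> S = - replicator S (\<Omega> ** S)"

definition equilibrium :: "real ^ 'n::finite ^ 'n \<Rightarrow> real ^ 'c::finite ^ 'n \<Rightarrow> bool" where
  "equilibrium \<Omega> S \<longleftrightarrow> S \<in> closure assignment_manifold \<and> replicator S (\<Omega> ** S) = 0"

text \<open>Local minimality is relative to the compact domain of the objective.\<close>

definition local_minimizer :: "real ^ 'n::finite ^ 'n \<Rightarrow> real ^ 'c::finite ^ 'n \<Rightarrow> bool" where
  "local_minimizer \<Omega> S \<longleftrightarrow> S \<in> closure assignment_manifold \<and>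
     (\<exists>e>0. \<forall>T\<in>closure assignment_manifold. dist T S < e \<longrightarrow> objective \<Omega> S \<le> objective \<Omega> T)"

section \<open>Geometric two-stage iteration\<close>

definition search_direction ::
    "real ^ 'n::finite ^ 'n \<Rightarrow> real ^ 'c::finite ^ 'n \<Rightarrow> real \<Rightarrow> real ^ 'c ^ 'n" where
  "search_direction \<Omega> S h = tangent_proj (\<Omega> ** S + (h / 2) *\<^sub>R (\<Omega> ** replicator S (\<Omega> ** S)))"

primrec iterates ::
    "real ^ 'n::finite ^ 'n \<Rightarrow> (nat \<Rightarrow> real) \<Rightarrow> (nat \<Rightarrow> real) \<Rightarrow> real ^ 'c::finite ^ 'n
      \<Rightarrow> nat \<Rightarrow> real ^ 'c ^ 'n" where
  "iterates \<Omega> h \<theta> S0 0 = S0"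
| "iterates \<Omega> h \<theta> S0 (Suc k) =
     (let S = iterates \<Omega> h \<theta> S0 k;
          S_half = liftings S (\<theta> k *\<^sub>R (\<Omega> ** S))
      in liftings S_half ((h k * \<theta> k / 2) *\<^sub>R (\<Omega> ** replicator S (\<Omega> ** S))))"

text \<open>In the curvature condition both the metric and the direction stay at the old iterate \<open>S\<close>;
  only the gradient is evaluated at the new iterate \<open>S'\<close>.\<close>

definition armijo ::
    "real ^ 'n::finite ^ 'n \<Rightarrow> real \<Rightarrow> real \<Rightarrow> real ^ 'c::finite ^ 'n \<Rightarrow> real ^ 'c ^ 'n
      \<Rightarrow> real ^ 'c ^ 'n \<Rightarrow> bool" where
  "armijo \<Omega> c\<^sub>1 t S d S' \<longleftrightarrow>
     objective \<Omega> S' - objective \<Omega> S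
       \<le> c\<^sub>1 * t * fisher_rao S (grad_objective \<Omega> S) (replicator S d)"

definition curvature ::
    "real ^ 'n::finite ^ 'n \<Rightarrow> real \<Rightarrow> real ^ 'c::finite ^ 'n \<Rightarrow> real ^ 'c ^ 'n
      \<Rightarrow> real ^ 'c ^ 'n \<Rightarrow> bool" where
  "curvature \<Omega> c\<^sub>2 S d S' \<longleftrightarrow>
     \<bar>fisher_rao S (grad_objective \<Omega> S') (replicator S d)\<bar>
       \<le> c\<^sub>2 * \<bar>fisher_rao S (grad_objective \<Omega> S) (replicator S d)\<bar>"

definition wolfe_iteration ::
    "real ^ 'n::finite ^ 'n \<Rightarrow> (nat \<Rightarrow> real) \<Rightarrow> (nat \<Rightarrow> real) \<Rightarrow> real \<Rightarrow> real
      \<Rightarrow> real ^ 'c::finite ^ 'n \<Rightarrow> bool" where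
  "wolfe_iteration \<Omega> h \<theta> c\<^sub>1 c\<^sub>2 S0 \<longleftrightarrow>
     0 < c\<^sub>1 \<and> c\<^sub>1 < c\<^sub>2 \<and> c\<^sub>2 < 1 \<and>
     (\<forall>k. let S = iterates \<Omega> h \<theta> S0 k;
              S' = iterates \<Omega> h \<theta> S0 (Suc k);
              d = search_direction \<Omega> S (h k)
          in armijo \<Omega> c\<^sub>1 (\<theta> k) S d S' \<and> curvature \<Omega> c\<^sub>2 S d S')"

text \<open>
  Since \<open>\<Omega>\<close> may be indefinite, a large \<open>h k\<close> can make the search direction orthogonal to the
  gradient, or even an ascent direction, and the two inequalities above do not exclude this.
  For example, if \<open>\<Omega>\<close> swaps two vertices, \<open>c = 2\<close>, and \<open>S\<close> has the rows \<open>(1/2 + a, 1/2 - a)\<close>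
  and \<open>(1/2 - a, 1/2 + a)\<close> with \<open>0 < a < 1/2\<close>, then \<open>search_direction \<Omega> S h = 0\<close> for
  \<open>h = 1 / (1/4 - a\<^sup>2)\<close>, so the iteration rests at \<open>S\<close>, which is not an equilibrium.
  The following is the sufficient-descent condition of line search methods;
  for symmetric, nonnegative \<open>\<Omega>\<close> with unit row sums it is implied by \<open>0 \<le> h k \<le> \<eta>\<close> with a
  constant \<open>\<eta> < 4\<close>, and by \<open>h k \<ge> 0\<close> if \<open>\<Omega>\<close> is positive semidefinite.
\<close>

definition sufficient_descent ::
    "real ^ 'n::finite ^ 'n \<Rightarrow> (nat \<Rightarrow> real) \<Rightarrow> (nat \<Rightarrow> real) \<Rightarrow> real ^ 'c::finite ^ 'n \<Rightarrow> bool" where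
  "sufficient_descent \<Omega> h \<theta> S0 \<longleftrightarrow>
     (\<exists>\<sigma>>0. \<forall>\<^sub>F k in sequentially.
        let S = iterates \<Omega> h \<theta> S0 k; g = grad_objective \<Omega> S
        in fisher_rao S g (replicator S (search_direction \<Omega> S (h k))) \<le> - \<sigma> * fisher_rao S g g)"

definition limit_point :: "(nat \<Rightarrow> 'a::topological_space) \<Rightarrow> 'a \<Rightarrow> bool" where
  "limit_point X l \<longleftrightarrow> (\<exists>r. strict_mono r \<and> (X \<circ> r) \<longlonglongrightarrow> l)"

section \<open>The Riemannian gradient\<close>

lemma replicator_component:
  "replicator S V $ x $ j = S $ x $ j * (V $ x $ j - (S $ x) \<bullet> (V $ x))"
proof -
  have "(\<Sum>k\<in>UNIV. ((if j = k then S $ x $ j else 0) - S $ x $ j * S $ x $ k) * V $ x $ k)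
      = (\<Sum>k\<in>UNIV. (if j = k then S $ x $ j * V $ x $ k else 0)
          - S $ x $ j * (S $ x $ k * V $ x $ k))"
    by (intro sum.cong) (auto simp: algebra_simps)
  also have "\<dots> = S $ x $ j * V $ x $ j - S $ x $ j * ((S $ x) \<bullet> (V $ x))"
    by (simp add: sum_subtractf sum_distrib_left inner_vec_def)
  finally show ?thesis
    by (simp add: replicator_def replicator_matrix_def matrix_vector_mult_def right_diff_distrib)
qed

lemma riemannian_gradient:
  fixes \<Omega> :: "real ^ 'n::finite ^ 'n" and S V :: "real ^ 'c::finite ^ 'n"
  assumes "transpose \<Omega> = \<Omega>" and pos: "\<And>x j. 0 < S $ x $ j" and V: "V \<in> tangent_space"
  shows "((\<lambda>t. objective \<Omega> (S + t *\<^sub>R V)) has_real_derivative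
           fisher_rao S (grad_objective \<Omega> S) V) (at 0)"
proof -
  have sym: "S \<bullet> (\<Omega> ** V) = V \<bullet> (\<Omega> ** S)"
  proof -
    have Om: "\<Omega> $ i $ j = \<Omega> $ j $ i" for i j
      using assms(1) by (metis transpose_def vec_lambda_beta)
    have "S \<bullet> (\<Omega> ** V) = (\<Sum>i\<in>UNIV. \<Sum>j\<in>UNIV. \<Sum>k\<in>UNIV. S $ i $ j * (\<Omega> $ i $ k * V $ k $ j))"
      by (simp add: inner_vec_def matrix_matrix_mult_def sum_distrib_left)
    also have "\<dots> = (\<Sum>i\<in>UNIV. \<Sum>k\<in>UNIV. \<Sum>j\<in>UNIV. S $ i $ j * (\<Omega> $ i $ k * V $ k $ j))"
      by (intro sum.cong refl sum.swap)
    also have "\<dots> = (\<Sum>k\<in>UNIV. \<Sum>i\<in>UNIV. \<Sum>j\<in>UNIV. S $ i $ j * (\<Omega> $ i $ k * V $ k $ j))"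
      by (rule sum.swap)
    also have "\<dots> = (\<Sum>k\<in>UNIV. \<Sum>j\<in>UNIV. \<Sum>i\<in>UNIV. V $ k $ j * (\<Omega> $ k $ i * S $ i $ j))"
    proof (intro sum.cong refl)
      fix k
      show "(\<Sum>i\<in>UNIV. \<Sum>j\<in>UNIV. S $ i $ j * (\<Omega> $ i $ k * V $ k $ j))
          = (\<Sum>j\<in>UNIV. \<Sum>i\<in>UNIV. V $ k $ j * (\<Omega> $ k $ i * S $ i $ j))"
        by (subst sum.swap, intro sum.cong refl) (simp add: Om[of _ k])
    qed
    also have "\<dots> = V \<bullet> (\<Omega> ** S)"
      by (simp add: inner_vec_def matrix_matrix_mult_def sum_distrib_left)
    finally show ?thesis .
  qed
  have mult: "\<Omega> ** (S + t *\<^sub>R V) = \<Omega> ** S + t *\<^sub>R (\<Omega> ** V)" for t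
    by (simp add: vec_eq_iff matrix_matrix_mult_def sum.distrib sum_distrib_left algebra_simps)
  have exp: "objective \<Omega> (S + t *\<^sub>R V)
      = objective \<Omega> S - t * (V \<bullet> (\<Omega> ** S)) - t\<^sup>2 / 2 * (V \<bullet> (\<Omega> ** V))" for t
    by (simp add: objective_def mult inner_add_left inner_add_right sym power2_eq_square algebra_simps)
  have "fisher_rao S (grad_objective \<Omega> S) V
      = (\<Sum>x\<in>UNIV. \<Sum>j\<in>UNIV. (((S $ x) \<bullet> ((\<Omega> ** S) $ x)) - (\<Omega> ** S) $ x $ j) * V $ x $ j)"
    unfolding fisher_rao_def grad_objective_def
    by (intro sum.cong refl)
      (use pos in \<open>auto simp: replicator_component field_simps less_imp_neq[symmetric]\<close>)
  also have "\<dots> = (\<Sum>x\<in>UNIV. ((S $ x) \<bullet> ((\<Omega> ** S) $ x)) * (1 \<bullet> (V $ x))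
                      - (V $ x) \<bullet> ((\<Omega> ** S) $ x))"
    by (simp add: left_diff_distrib sum_subtractf flip: sum_distrib_left)
      (simp add: inner_vec_def mult.commute)
  also have "\<dots> = - (V \<bullet> (\<Omega> ** S))"
    using V by (simp add: tangent_space_def inner_vec_def[of V] sum_negf)
  finally show ?thesis
    unfolding exp by (auto intro!: derivative_eq_intros)
qed

end

theory Submission
  imports Defs
begin

text \<open>
  Everything rests on two identities.  On the tangent space the Fisher--Rao metric absorbs the
  replicator, \<open>\<langle>U, R\<^sub>S d\<rangle>\<^sub>S = U \<bullet> d\<close> (\<open>fisher_rao_replicator\<close>), and the replicator is self-adjoint.
  Hence the quantities in the Armijo and curvature conditions are the values at \<open>0\<close> and at
  \<open>\<theta>\<close> of the derivative of the one real function \<open>\<phi> t = J (exp\<^sub>S (t d))\<close>: although the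
  curvature condition pairs the new gradient with the old metric and the old direction, that
  pairing is exactly \<open>\<phi>' \<theta>\<close> (\<open>objective_along_lifting\<close>).  The two stages of the iteration merge
  into one exponential step because liftings compose additively and ignore row-wise constants
  (\<open>iterates_Suc_eq_liftings\<close>).

  \<^emph>\<open>Existence.\<close>  With \<open>G = R\<^sub>S (\<Omega> S)\<close> the slope \<open>\<phi>' 0\<close> is \<open>- \<langle>G, G\<rangle>\<^sub>S - (h / 2) (G \<bullet> \<Omega> G)\<close>.
  A symmetric nonnegative matrix with unit row sums has norm at most one, and entries of \<open>S\<close> are at
  most one, so \<open>\<bar>G \<bullet> \<Omega> G\<bar> \<le> \<parallel>G\<parallel>\<^sup>2 \<le> \<langle>G, G\<rangle>\<^sub>S\<close>, and \<open>0 \<le> h \<le> 1\<close> gives sufficient descent with the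
  constant \<open>1 / 2\<close>.  Since \<open>J\<close> is bounded below on the assignment manifold, minimizing
  \<open>\<phi> t - c\<^sub>1 t \<phi>' 0\<close> produces a step that satisfies both conditions (\<open>strong_wolfe_step\<close>).

  \<^emph>\<open>Convergence.\<close>  Step sizes bounded away from zero, Armijo and sufficient descent make the
  decrease of \<open>J\<close> in each step dominate a multiple of \<open>\<parallel>grad J\<parallel>\<^sup>2\<close>.  As \<open>J\<close> is bounded below, the
  gradient tends to zero along the whole sequence, and by continuity limit points are equilibria.
  Summability of \<open>h\<close> forces \<open>h \<longlonglongrightarrow> 0\<close>, which makes sufficient descent automatic.

  \<^emph>\<open>Minimizers.\<close>  An interior local minimizer does not exist at all: in a direction whose
  rows all equal one vector \<open>v\<close> with zero sum, \<open>\<Omega>\<close> acts as the identity, so \<open>J\<close> is strictly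
  concave on that line (\<open>local_minimizer_not_interior\<close>).
\<close>

section \<open>Points of the assignment manifold\<close>

lemma rel_interior_prob_simplex:
  "rel_interior prob_simplex =
     {p :: real ^ 'c::finite. (\<forall>j. 0 < p $ j) \<and> (\<Sum>j\<in>UNIV. p $ j) = 1}"
proof -
  let ?D = "prob_simplex :: (real ^ 'c) set"
  have axis: "axis j 1 \<in> ?D" for j
    by (auto simp: prob_simplex_def axis_def)
  have conv: "convex ?D"
    by (auto simp: convex_def prob_simplex_def sum.distrib simp flip: sum_distrib_left)
  have "z \<in> rel_interior ?D \<longleftrightarrow> (\<forall>j. 0 < z $ j) \<and> (\<Sum>j\<in>UNIV. z $ j) = 1" for z
  proof
    assume z: "z \<in> rel_interior ?D"
    have "0 < z $ j" for j
    proof -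
      obtain e where "e > 1" and e: "(1 - e) *\<^sub>R axis j 1 + e *\<^sub>R z \<in> ?D"
        using z axis conv by (metis convex_rel_interior_iff empty_iff)
      have "0 \<le> (1 - e) + e * z $ j"
        using e unfolding prob_simplex_def by (auto dest: spec[of _ j])
      with \<open>e > 1\<close> show ?thesis
        by (smt (verit) mult_nonneg_nonpos)
    qed
    moreover have "z \<in> ?D"
      using z rel_interior_subset by blast
    ultimately show "(\<forall>j. 0 < z $ j) \<and> (\<Sum>j\<in>UNIV. z $ j) = 1"
      by (simp add: prob_simplex_def)
  next
    assume z: "(\<forall>j. 0 < z $ j) \<and> (\<Sum>j\<in>UNIV. z $ j) = 1"
    define m where "m = Min (range (\<lambda>j. z $ j))"
    have m: "0 < m" "m \<le> z $ j" for j
      using z by (auto simp: m_def)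
    have "(1 - (1 + m)) *\<^sub>R x + (1 + m) *\<^sub>R z \<in> ?D" if x: "x \<in> ?D" for x
    proof -
      have "x $ j \<le> 1" for j
        using x member_le_sum[of j UNIV "\<lambda>j. x $ j"] by (simp add: prob_simplex_def)
      then have "m * x $ j \<le> m" for j
        using m(1) by (simp add: mult_left_le)
      moreover have "m \<le> (1 + m) * z $ j" for j
        using m(2)[of j] mult_pos_pos[OF m(1), of "z $ j"] z by (simp add: distrib_right)
      ultimately have "m * x $ j \<le> (1 + m) * z $ j" for j
        by (rule order_trans)
      moreover have "(\<Sum>j\<in>UNIV. (1 + m) * z $ j - m * x $ j) = 1"
        using x z by (simp add: sum_subtractf prob_simplex_def flip: sum_distrib_left)
      ultimately show ?thesis
        by (simp add: prob_simplex_def)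
    qed
    then show "z \<in> rel_interior ?D"
      using axis conv m(1) by (metis convex_rel_interior_iff empty_iff less_add_same_cancel1)
  qed
  then show ?thesis by blast
qed

lemma assignment_manifold_iff:
  "S \<in> assignment_manifold \<longleftrightarrow> (\<forall>x j. 0 < S $ x $ j) \<and> (\<forall>x. (\<Sum>j\<in>UNIV. S $ x $ j) = 1)"
  by (auto simp: assignment_manifold_def rel_interior_prob_simplex)

lemma assignment_manifold_pos: "S \<in> assignment_manifold \<Longrightarrow> 0 < S $ x $ j"
  and assignment_manifold_sum: "S \<in> assignment_manifold \<Longrightarrow> (\<Sum>j\<in>UNIV. S $ x $ j) = 1"
  by (auto simp: assignment_manifold_iff)

lemma assignment_manifold_le_1: "S \<in> assignment_manifold \<Longrightarrow> S $ x $ j \<le> 1"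
  using member_le_sum[of j UNIV "\<lambda>j. S $ x $ j"]
  by (simp add: assignment_manifold_pos less_imp_le assignment_manifold_sum)

lemma norm_assignment_le:
  fixes S :: "real ^ 'c::finite ^ 'n::finite"
  assumes "S \<in> assignment_manifold"
  shows "S \<bullet> S \<le> real CARD('n)"
proof -
  have "S $ x \<bullet> S $ x \<le> 1" for x
  proof -
    have "S $ x \<bullet> S $ x \<le> (\<Sum>j\<in>UNIV. S $ x $ j)"
      unfolding inner_vec_def
      by (intro sum_mono)
        (simp add: assms assignment_manifold_le_1 assignment_manifold_pos less_imp_le mult_left_le)
    then show ?thesis by (simp add: assms assignment_manifold_sum)
  qed
  then show ?thesis
    using sum_mono[of UNIV "\<lambda>x. S $ x \<bullet> S $ x" "\<lambda>_. 1"] by (simp add: inner_vec_def[of S])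
qed

section \<open>Liftings\<close>

lemma lifting_denominator_pos:
  fixes p v :: "real ^ 'c::finite"
  assumes "\<And>j. 0 < p $ j"
  shows "0 < (\<Sum>i\<in>UNIV. p $ i * exp (v $ i))"
  by (intro sum_pos) (use assms in auto)

lemma liftings_in_assignment_manifold:
  assumes "S \<in> assignment_manifold"
  shows "liftings S V \<in> assignment_manifold"
proof -
  have "0 < (\<Sum>i\<in>UNIV. S $ x $ i * exp (V $ x $ i))" for x
    by (rule lifting_denominator_pos) (simp add: assms assignment_manifold_pos)
  then show ?thesis
    using assms
    by (simp add: assignment_manifold_iff liftings_def lifting_def less_imp_neq[symmetric]
        flip: sum_divide_distrib)
qed

lemma lifting_lifting:
  assumes "\<And>j. 0 < p $ j"
  shows "lifting (lifting p u) v = lifting p (u + v)"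
  using lifting_denominator_pos[OF assms, of u]
  by (simp add: lifting_def vec_eq_iff exp_add mult.assoc flip: sum_divide_distrib)

lemma liftings_liftings:
  "S \<in> assignment_manifold \<Longrightarrow> liftings (liftings S U) V = liftings S (U + V)"
  by (simp add: liftings_def lifting_lifting assignment_manifold_pos)

lemma lifting_shift: "lifting p (v - a *\<^sub>R 1) = lifting p v"
proof -
  have "p $ j * exp (v $ j - a) = exp (- a) * (p $ j * exp (v $ j))" for j
    by (simp add: exp_diff exp_minus field_simps)
  note eq = this
  show ?thesis
    by (simp add: lifting_def vec_eq_iff eq flip: sum_distrib_left)
qed

lemma liftings_tangent_proj: "liftings S (t *\<^sub>R tangent_proj V) = liftings S (t *\<^sub>R V)"
  by (simp add: liftings_def tangent_proj_def scaleR_diff_right lifting_shift)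

lemma liftings_0: "S \<in> assignment_manifold \<Longrightarrow> liftings S 0 = S"
  by (simp add: liftings_def lifting_def vec_eq_iff assignment_manifold_sum)

lemma iterates_in_assignment_manifold:
  "S0 \<in> assignment_manifold \<Longrightarrow> iterates \<Omega> h \<theta> S0 k \<in> assignment_manifold"
  by (induction k) (simp_all add: Let_def liftings_in_assignment_manifold)

text \<open>The half step and the correction add up in the exponent, and the projection in the search
  direction changes the exponent only by row-wise constants.\<close>

lemma iterates_Suc_eq_liftings:
  assumes "S0 \<in> assignment_manifold"
  shows "iterates \<Omega> h \<theta> S0 (Suc k) =
    liftings (iterates \<Omega> h \<theta> S0 k)
      (\<theta> k *\<^sub>R search_direction \<Omega> (iterates \<Omega> h \<theta> S0 k) (h k))"
  using iterates_in_assignment_manifold[OF assms]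
  by (simp add: Let_def liftings_liftings search_direction_def liftings_tangent_proj
      scaleR_add_right mult.commute)

section \<open>The replicator and the Fisher--Rao metric\<close>

lemma tangent_space_iff: "V \<in> tangent_space \<longleftrightarrow> (\<forall>x. (\<Sum>j\<in>UNIV. V $ x $ j) = 0)"
  by (simp add: tangent_space_def inner_vec_def)

lemma tangent_proj_in_tangent_space: "tangent_proj V \<in> tangent_space"
  by (simp add: tangent_space_iff tangent_proj_def sum_subtractf inner_vec_def)

lemma replicator_in_tangent_space:
  assumes "S \<in> assignment_manifold"
  shows "replicator S V \<in> tangent_space"
  by (simp add: tangent_space_iff replicator_component right_diff_distrib sum_subtractf
      inner_vec_def assms assignment_manifold_sum flip: sum_distrib_right)

lemma replicator_self_adjoint: "U \<bullet> replicator S V = replicator S U \<bullet> V"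
proof -
  have "U $ x \<bullet> replicator S V $ x = replicator S U $ x \<bullet> V $ x" for x
  proof -
    have "U $ x \<bullet> replicator S V $ x
        = (\<Sum>j\<in>UNIV. S $ x $ j * U $ x $ j * V $ x $ j) - (S $ x \<bullet> U $ x) * (S $ x \<bullet> V $ x)"
      by (simp add: inner_vec_def[of "U $ x"] inner_vec_def[of "S $ x" "U $ x"]
          replicator_component right_diff_distrib
          sum_subtractf sum_distrib_right ac_simps)
        (simp add: sum_distrib_left ac_simps)
    also have "\<dots> = replicator S U $ x \<bullet> V $ x"
      by (simp add: inner_vec_def[of _ "V $ x"] replicator_component right_diff_distrib
          left_diff_distrib sum_subtractf sum_distrib_left ac_simps)
    finally show ?thesis .
  qed
  then show ?thesis
    by (simp add: inner_vec_def[of U] inner_vec_def[of _ V])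
qed

lemma tangent_proj_inner:
  assumes "U \<in> tangent_space"
  shows "U \<bullet> tangent_proj V = U \<bullet> V"
proof -
  have "U $ x \<bullet> 1 = 0" for x
    using assms by (simp add: tangent_space_def inner_commute)
  then show ?thesis
    by (simp add: inner_vec_def[of U] tangent_proj_def inner_diff_right)
qed

text \<open>The metric divides by \<open>S\<close> the factor \<open>S\<close> that the replicator multiplies with; the mean that
  the replicator subtracts is constant on rows, hence orthogonal to tangent vectors.\<close>

lemma fisher_rao_replicator:
  assumes S: "S \<in> assignment_manifold" and U: "U \<in> tangent_space"
  shows "fisher_rao S U (replicator S V) = U \<bullet> V"
proof -
  have "fisher_rao S U (replicator S V)
      = (\<Sum>x\<in>UNIV. \<Sum>j\<in>UNIV. U $ x $ j * V $ x $ j - U $ x $ j * (S $ x \<bullet> V $ x))"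
    unfolding fisher_rao_def
  proof (intro sum.cong refl)
    fix x j
    have "S $ x $ j \<noteq> 0"
      using assignment_manifold_pos[OF S, of x j] by simp
    then show "U $ x $ j * replicator S V $ x $ j / S $ x $ j
        = U $ x $ j * V $ x $ j - U $ x $ j * (S $ x \<bullet> V $ x)"
      by (simp add: replicator_component field_simps)
  qed
  also have "\<dots> = U \<bullet> V"
    using U by (simp add: sum_subtractf tangent_space_iff inner_vec_def[of U]
        inner_vec_def[of "U $ _"] flip: sum_distrib_right)
  finally show ?thesis .
qed

lemma grad_objective_in_tangent_space:
  "S \<in> assignment_manifold \<Longrightarrow> grad_objective \<Omega> S \<in> tangent_space"
  using replicator_in_tangent_space[of S "\<Omega> ** S"]
  by (simp add: grad_objective_def tangent_space_iff sum_negf)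

text \<open>The coordinates \<open>S\<close> in the denominators of the metric are at most one.\<close>

lemma norm_le_fisher_rao:
  assumes "S \<in> assignment_manifold"
  shows "U \<bullet> U \<le> fisher_rao S U U"
proof -
  have "U $ x $ j * U $ x $ j \<le> U $ x $ j * U $ x $ j / S $ x $ j" for x j
    using assignment_manifold_pos[OF assms, of x j] assignment_manifold_le_1[OF assms, of x j]
    by (simp add: le_divide_eq mult_left_le)
  then show ?thesis
    by (auto simp: fisher_rao_def inner_vec_def intro!: sum_mono)
qed

section \<open>The objective along a lifting\<close>

lemma lifting_has_derivative:
  assumes "\<And>j. 0 < p $ j"
  shows "((\<lambda>t. lifting p (t *\<^sub>R v) $ j) has_real_derivative
     lifting p (t *\<^sub>R v) $ j * (v $ j - lifting p (t *\<^sub>R v) \<bullet> v)) (at t)"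
proof -
  let ?Z = "\<Sum>i\<in>UNIV. p $ i * exp (t * v $ i)"
  have Z: "?Z > 0"
    using lifting_denominator_pos[OF assms, of "t *\<^sub>R v"] by simp
  have "((\<lambda>t. p $ j * exp (t * v $ j) / (\<Sum>i\<in>UNIV. p $ i * exp (t * v $ i))) has_real_derivative
      (p $ j * (exp (t * v $ j) * v $ j) * ?Z
        - p $ j * exp (t * v $ j) * (\<Sum>i\<in>UNIV. p $ i * (exp (t * v $ i) * v $ i)))
      / (?Z * ?Z)) (at t)"
    using Z by (auto intro!: derivative_eq_intros simp: ac_simps)
  also have "(p $ j * (exp (t * v $ j) * v $ j) * ?Z
        - p $ j * exp (t * v $ j) * (\<Sum>i\<in>UNIV. p $ i * (exp (t * v $ i) * v $ i)))
      / (?Z * ?Z)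
    = p $ j * exp (t * v $ j) / ?Z
      * (v $ j - (\<Sum>i\<in>UNIV. p $ i * (exp (t * v $ i) * v $ i)) / ?Z)"
  proof -
    have "(a * (E * w) * z - a * E * N) / (z * z) = a * E / z * (w - N / z)"
      if "z > 0" for a E w N z :: real
      using that by (simp add: field_simps)
    from this[OF Z] show ?thesis .
  qed
  finally show ?thesis
    by (simp add: lifting_def inner_vec_def mult.assoc flip: sum_divide_distrib)
qed

lemma matrix_mult_component: "(A ** B) $ x $ j = (\<Sum>y\<in>UNIV. A $ x $ y * B $ y $ j)"
  by (simp add: matrix_matrix_mult_def)

lemma matrix_mult_add_scaleR:
  fixes A :: "real ^ 'n::finite ^ 'm::finite"
  shows "A ** (U + t *\<^sub>R V) = A ** U + t *\<^sub>R (A ** V)"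
  by (simp add: vec_eq_iff matrix_mult_component sum.distrib sum_distrib_left algebra_simps)

locale averaging_matrix =
  fixes \<Omega> :: "real ^ 'n::finite ^ 'n"
  assumes symmetric: "\<Omega> $ x $ y = \<Omega> $ y $ x"
    and nonneg: "0 \<le> \<Omega> $ x $ y"
    and row_sum: "(\<Sum>y\<in>UNIV. \<Omega> $ x $ y) = 1"
begin

lemma inner_mult_eq:
  fixes U V :: "real ^ 'c::finite ^ 'n"
  shows "U \<bullet> (\<Omega> ** V) = (\<Sum>x\<in>UNIV. \<Sum>y\<in>UNIV. \<Omega> $ x $ y * (U $ x \<bullet> V $ y))"
proof -
  have "U $ x \<bullet> (\<Omega> ** V) $ x = (\<Sum>y\<in>UNIV. \<Omega> $ x $ y * (U $ x \<bullet> V $ y))" for x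
  proof -
    have "U $ x \<bullet> (\<Omega> ** V) $ x = (\<Sum>j\<in>UNIV. \<Sum>y\<in>UNIV. \<Omega> $ x $ y * (U $ x $ j * V $ y $ j))"
      by (simp add: inner_vec_def matrix_mult_component sum_distrib_left mult.left_commute)
    also have "\<dots> = (\<Sum>y\<in>UNIV. \<Sum>j\<in>UNIV. \<Omega> $ x $ y * (U $ x $ j * V $ y $ j))"
      by (rule sum.swap)
    finally show ?thesis
      by (simp add: inner_vec_def sum_distrib_left)
  qed
  then show ?thesis
    by (simp add: inner_vec_def[of U])
qed

lemma inner_mult_symmetric:
  fixes U V :: "real ^ 'c::finite ^ 'n"
  shows "U \<bullet> (\<Omega> ** V) = V \<bullet> (\<Omega> ** U)"
proof -
  have "U \<bullet> (\<Omega> ** V) = (\<Sum>y\<in>UNIV. \<Sum>x\<in>UNIV. \<Omega> $ x $ y * (U $ x \<bullet> V $ y))"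
    unfolding inner_mult_eq by (rule sum.swap)
  also have "\<dots> = V \<bullet> (\<Omega> ** U)"
    unfolding inner_mult_eq by (intro sum.cong refl) (metis symmetric inner_commute)
  finally show ?thesis .
qed

text \<open>The matrix has norm at most one: by \<open>2 \<bar>u \<bullet> v\<bar> \<le> \<parallel>u\<parallel>\<^sup>2 + \<parallel>v\<parallel>\<^sup>2\<close> the quadratic form is bounded
  by the average of the row sums and the column sums, weighted with \<open>\<parallel>V x\<parallel>\<^sup>2\<close>.\<close>

lemma quadratic_form_bound:
  fixes V :: "real ^ 'c::finite ^ 'n"
  shows "\<bar>V \<bullet> (\<Omega> ** V)\<bar> \<le> V \<bullet> V"
proof -
  have uv: "\<bar>u \<bullet> v\<bar> \<le> (u \<bullet> u) / 2 + (v \<bullet> v) / 2" for u v :: "real ^ 'c"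
    using inner_ge_zero[of "u + v"] inner_ge_zero[of "u - v"]
    by (simp add: inner_add_left inner_add_right inner_diff_left inner_diff_right
        inner_commute[of v u] abs_le_iff)
  have "\<bar>V \<bullet> (\<Omega> ** V)\<bar> \<le> (\<Sum>x\<in>UNIV. \<Sum>y\<in>UNIV. \<bar>\<Omega> $ x $ y * (V $ x \<bullet> V $ y)\<bar>)"
    unfolding inner_mult_eq
    by (rule order_trans[OF sum_abs]) (intro sum_mono sum_abs)
  also have "\<dots> \<le> (\<Sum>x\<in>UNIV. \<Sum>y\<in>UNIV.
      \<Omega> $ x $ y * (V $ x \<bullet> V $ x / 2) + \<Omega> $ x $ y * (V $ y \<bullet> V $ y / 2))"
  proof (intro sum_mono)
    fix x y
    have "\<Omega> $ x $ y * \<bar>V $ x \<bullet> V $ y\<bar> \<le> \<Omega> $ x $ y * (V $ x \<bullet> V $ x / 2 + V $ y \<bullet> V $ y / 2)"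
      by (intro mult_left_mono uv nonneg)
    then show "\<bar>\<Omega> $ x $ y * (V $ x \<bullet> V $ y)\<bar>
        \<le> \<Omega> $ x $ y * (V $ x \<bullet> V $ x / 2) + \<Omega> $ x $ y * (V $ y \<bullet> V $ y / 2)"
      by (simp add: abs_mult nonneg distrib_left)
  qed
  also have "\<dots> = (\<Sum>x\<in>UNIV. V $ x \<bullet> V $ x / 2)
      + (\<Sum>x\<in>UNIV. \<Sum>y\<in>UNIV. \<Omega> $ x $ y * (V $ y \<bullet> V $ y / 2))"
    by (simp add: sum.distrib row_sum del: times_divide_eq_right flip: sum_distrib_right)
  also have "(\<Sum>x\<in>UNIV. \<Sum>y\<in>UNIV. \<Omega> $ x $ y * (V $ y \<bullet> V $ y / 2))
      = (\<Sum>y\<in>UNIV. V $ y \<bullet> V $ y / 2)"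
    by (subst sum.swap, subst symmetric) (simp add: row_sum del: times_divide_eq_right flip: sum_distrib_right)
  finally show ?thesis
    by (simp add: inner_vec_def[of V] flip: sum_divide_distrib)
qed

lemma objective_lower_bound:
  fixes S :: "real ^ 'c::finite ^ 'n"
  assumes "S \<in> assignment_manifold"
  shows "- real CARD('n) / 2 \<le> objective \<Omega> S"
  using quadratic_form_bound[of S] norm_assignment_le[OF assms]
  by (simp add: objective_def)

text \<open>The derivative of \<open>J\<close> along the curve is \<open>- (\<Omega> S') \<bullet> R\<^sub>S\<^sub>' d\<close> at \<open>S' = exp\<^sub>S (t d)\<close>.
  Self-adjointness moves \<open>R\<^sub>S\<^sub>'\<close> to the other factor, where it is the gradient at \<open>S'\<close>; the remaining
  Euclidean pairing with \<open>d\<close> equals the Fisher--Rao pairing with \<open>R\<^sub>S d\<close> for \<^emph>\<open>every\<close> base point \<open>S\<close>.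
  This is why the curvature condition may keep the old metric and the old direction.\<close>

lemma objective_along_lifting:
  fixes S d :: "real ^ 'c::finite ^ 'n"
  assumes S: "S \<in> assignment_manifold"
  shows "((\<lambda>t. objective \<Omega> (liftings S (t *\<^sub>R d))) has_real_derivative
    fisher_rao S (grad_objective \<Omega> (liftings S (t *\<^sub>R d))) (replicator S d)) (at t)"
proof -
  define X where "X = (\<lambda>t. liftings S (t *\<^sub>R d))"
  have X: "X t \<in> assignment_manifold" for t
    by (simp add: X_def S liftings_in_assignment_manifold)
  have d: "((\<lambda>t. X t $ x $ j) has_real_derivative replicator (X t) d $ x $ j) (at t)" for x j
    using lifting_has_derivative[of "S $ x" "d $ x" j t] assignment_manifold_pos[OF S]
    by (simp add: X_def liftings_def replicator_component)
  let ?R = "replicator (X t) d"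
  have "((\<lambda>t. - (1/2) * (\<Sum>x\<in>UNIV. \<Sum>j\<in>UNIV. X t $ x $ j * (\<Sum>y\<in>UNIV. \<Omega> $ x $ y * X t $ y $ j)))
      has_real_derivative
      - (1/2) * (\<Sum>x\<in>UNIV. \<Sum>j\<in>UNIV. X t $ x $ j * (\<Sum>y\<in>UNIV. \<Omega> $ x $ y * ?R $ y $ j)
                  + ?R $ x $ j * (\<Sum>y\<in>UNIV. \<Omega> $ x $ y * X t $ y $ j))) (at t)"
    by (intro DERIV_cmult DERIV_sum DERIV_mult' d)
  also have "- (1/2) * (\<Sum>x\<in>UNIV. \<Sum>j\<in>UNIV. X t $ x $ j * (\<Sum>y\<in>UNIV. \<Omega> $ x $ y * ?R $ y $ j)
        + ?R $ x $ j * (\<Sum>y\<in>UNIV. \<Omega> $ x $ y * X t $ y $ j))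
      = - (1/2) * (X t \<bullet> (\<Omega> ** ?R) + ?R \<bullet> (\<Omega> ** X t))"
    by (simp add: inner_vec_def matrix_mult_component sum.distrib)
  also have "\<dots> = - (?R \<bullet> (\<Omega> ** X t))"
    by (simp add: inner_mult_symmetric)
  also have "\<dots> = grad_objective \<Omega> (X t) \<bullet> d"
    by (metis grad_objective_def inner_commute inner_minus_left replicator_self_adjoint)
  also have "\<dots> = fisher_rao S (grad_objective \<Omega> (X t)) (replicator S d)"
    by (simp add: fisher_rao_replicator S X grad_objective_in_tangent_space)
  finally show ?thesis
    by (simp add: X_def objective_def inner_vec_def matrix_mult_component)
qed

section \<open>Descent of the search direction\<close>

text \<open>The summand \<open>\<Omega> S\<close> of the search direction contributes exactly the squared Fisher--Rao norm
  of the gradient; the second-order correction contributes a quadratic form of \<open>\<Omega>\<close> in the gradient, whose sign is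
  unknown because \<open>\<Omega>\<close> may be indefinite.\<close>

lemma slope_search_direction:
  fixes S :: "real ^ 'c::finite ^ 'n"
  assumes S: "S \<in> assignment_manifold"
  defines "g \<equiv> grad_objective \<Omega> S"
  shows "fisher_rao S g (replicator S (search_direction \<Omega> S h))
    = - fisher_rao S g g - h / 2 * (g \<bullet> (\<Omega> ** g))"
proof -
  let ?G = "replicator S (\<Omega> ** S)"
  have gt: "g \<in> tangent_space"
    by (simp add: g_def S grad_objective_in_tangent_space)
  have gG: "g = - ?G"
    by (simp add: g_def grad_objective_def)
  have 1: "fisher_rao S g (replicator S (search_direction \<Omega> S h))
      = g \<bullet> (\<Omega> ** S) + h / 2 * (g \<bullet> (\<Omega> ** ?G))"
    by (simp add: fisher_rao_replicator S gt search_direction_def tangent_proj_inner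
        inner_add_right)
  have 2: "\<Omega> ** ?G = - (\<Omega> ** g)"
    by (simp add: gG vec_eq_iff matrix_mult_component sum_negf)
  have "fisher_rao S g g = - fisher_rao S g ?G"
    by (subst (2) gG) (simp add: fisher_rao_def sum_negf)
  also have "\<dots> = - (g \<bullet> (\<Omega> ** S))"
    by (simp add: fisher_rao_replicator S gt)
  finally show ?thesis
    by (simp add: 1 2)
qed

text \<open>The indefinite term is at most half of the squared Fisher--Rao norm as long as \<open>h \<le> 1\<close>.\<close>

lemma slope_search_direction_le:
  fixes S :: "real ^ 'c::finite ^ 'n"
  assumes S: "S \<in> assignment_manifold" and h: "0 \<le> h" "h \<le> 1"
  defines "g \<equiv> grad_objective \<Omega> S"
  shows "fisher_rao S g (replicator S (search_direction \<Omega> S h)) \<le> - (1/2) * fisher_rao S g g"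
proof -
  have "- (g \<bullet> (\<Omega> ** g)) \<le> fisher_rao S g g"
    using quadratic_form_bound[of g] norm_le_fisher_rao[OF S, of g] by linarith
  then have "h * (- (g \<bullet> (\<Omega> ** g))) \<le> h * fisher_rao S g g"
    using h(1) by (rule mult_left_mono)
  moreover have "0 \<le> fisher_rao S g g"
    using norm_le_fisher_rao[OF S, of g] inner_ge_zero[of g] by linarith
  then have "h * fisher_rao S g g \<le> fisher_rao S g g"
    using h(2) by (simp add: mult_right_le_one_le mult_left_le_one_le h(1))
  ultimately show ?thesis
    using slope_search_direction[OF S, of h] unfolding g_def by simp
qed

lemma sufficient_descent_if_small:
  fixes S0 :: "real ^ 'c::finite ^ 'n"
  assumes "S0 \<in> assignment_manifold" and "\<forall>\<^sub>F k in sequentially. 0 \<le> h k \<and> h k \<le> 1"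
  shows "sufficient_descent \<Omega> h \<theta> S0"
  unfolding sufficient_descent_def Let_def
  by (rule exI[of _ "1/2"])
    (use assms(2) in \<open>auto elim!: eventually_mono
      intro: slope_search_direction_le[simplified] iterates_in_assignment_manifold[OF assms(1)]\<close>)

end

section \<open>Existence of Wolfe steps\<close>

text \<open>The line through the starting value with slope \<open>c \<cdot> D 0\<close> lies above the graph near \<open>0\<close> and, as
  \<open>\<phi>\<close> is bounded below, under it eventually.  Where \<open>\<phi>\<close> is furthest under the line, it has the
  slope of the line, so that both inequalities hold there, the second with equality.\<close>

lemma strong_wolfe_step:
  fixes \<phi> D :: "real \<Rightarrow> real"
  assumes D: "\<And>t. (\<phi> has_real_derivative D t) (at t)"
    and below: "\<And>t. B \<le> \<phi> t" and D0: "D 0 < 0" and c: "0 < c" "c < 1"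
  shows "\<exists>t>0. \<phi> t - \<phi> 0 \<le> c * t * D 0 \<and> \<bar>D t\<bar> = c * \<bar>D 0\<bar>"
proof -
  define \<psi> where "\<psi> t = \<phi> t - \<phi> 0 - c * t * D 0" for t
  have d\<psi>: "(\<psi> has_real_derivative D t - c * D 0) (at t)" for t
    unfolding \<psi>_def by (auto intro!: derivative_eq_intros D)
  have "D 0 - c * D 0 < 0"
    using mult_strict_right_mono_neg[OF c(2) D0] by simp
  from DERIV_neg_dec_right[OF d\<psi> this]
  obtain e where "e > 0" and e: "\<And>s. s > 0 \<Longrightarrow> s < e \<Longrightarrow> \<psi> s < \<psi> 0"
    by auto
  \<comment> \<open>Beyond \<open>(B - \<phi> 0) / (c D 0)\<close> the line has fallen below the lower bound \<open>B\<close>.\<close>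
  define M where "M = max e ((B - \<phi> 0) / (c * D 0))"
  have cD: "c * D 0 < 0"
    using c(1) D0 by (rule mult_pos_neg)
  have "M > 0" "e \<le> M"
    using \<open>e > 0\<close> by (auto simp: M_def)
  have "M * (c * D 0) \<le> B - \<phi> 0"
  proof -
    have "(B - \<phi> 0) / (c * D 0) \<le> M" by (simp add: M_def)
    then show ?thesis using cD by (simp add: neg_divide_le_eq)
  qed
  then have M: "0 \<le> \<psi> M"
    using below[of M] by (simp add: \<psi>_def mult.commute mult.left_commute)
  have "continuous_on {0..M} \<psi>"
    by (meson DERIV_continuous_on DERIV_subset d\<psi> subset_UNIV)
  then obtain t where t: "t \<in> {0..M}" and min: "\<And>s. s \<in> {0..M} \<Longrightarrow> \<psi> t \<le> \<psi> s"
    using continuous_attains_inf[of "{0..M}" \<psi>] \<open>M > 0\<close> by auto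
  have "\<psi> t < 0"
    using min[of "e / 2"] e[of "e / 2"] \<open>e > 0\<close> \<open>e \<le> M\<close> by (simp add: \<psi>_def)
  then have "t \<noteq> 0" "t \<noteq> M"
    using M by (auto simp: \<psi>_def)
  then have tt: "0 < t" "t < M"
    using t by auto
  have "D t - c * D 0 = 0"
  proof (rule DERIV_local_min[OF d\<psi>])
    show "0 < min t (M - t)" using tt by simp
    show "\<forall>s. \<bar>t - s\<bar> < min t (M - t) \<longrightarrow> \<psi> t \<le> \<psi> s"
      by (auto intro!: min simp: abs_less_iff)
  qed
  then have "\<bar>D t\<bar> = c * \<bar>D 0\<bar>"
    using c by (simp add: abs_mult)
  with tt \<open>\<psi> t < 0\<close> show ?thesis
    by (auto simp: \<psi>_def intro!: exI[of _ t])
qed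

context averaging_matrix
begin

text \<open>At an interior equilibrium \<open>\<Omega> S\<close> is constant on rows, so the search direction vanishes, the
  iteration rests, and every step size is admissible.\<close>

lemma wolfe_step_exists:
  fixes S :: "real ^ 'c::finite ^ 'n"
  assumes S: "S \<in> assignment_manifold" and h: "0 \<le> h" "h \<le> 1" and c: "0 < c\<^sub>1" "c\<^sub>1 \<le> c\<^sub>2" "c\<^sub>1 < 1"
  shows "\<exists>t>0. armijo \<Omega> c\<^sub>1 t S (search_direction \<Omega> S h)
                 (liftings S (t *\<^sub>R search_direction \<Omega> S h)) \<and>
               curvature \<Omega> c\<^sub>2 S (search_direction \<Omega> S h)
                 (liftings S (t *\<^sub>R search_direction \<Omega> S h))"
proof -
  define d where "d = search_direction \<Omega> S h"
  define D where "D t = fisher_rao S (grad_objective \<Omega> (liftings S (t *\<^sub>R d))) (replicator S d)" for t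
  define g where "g = grad_objective \<Omega> S"
  have D0: "D 0 = fisher_rao S g (replicator S d)"
    by (simp add: D_def g_def liftings_0 S)
  have D0_le: "D 0 \<le> - (1/2) * fisher_rao S g g"
    unfolding D0 g_def d_def by (rule slope_search_direction_le[OF S h])
  show ?thesis
  proof (cases "g = 0")
    case False
    then have "0 < fisher_rao S g g"
      using norm_le_fisher_rao[OF S, of g] inner_gt_zero_iff[of g] by linarith
    then have "D 0 < 0" using D0_le by simp
    then obtain t where t: "t > 0"
        "objective \<Omega> (liftings S (t *\<^sub>R d)) - objective \<Omega> (liftings S (0 *\<^sub>R d)) \<le> c\<^sub>1 * t * D 0"
        "\<bar>D t\<bar> = c\<^sub>1 * \<bar>D 0\<bar>"
      using strong_wolfe_step[of "\<lambda>t. objective \<Omega> (liftings S (t *\<^sub>R d))" D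
          "- real CARD('n) / 2" c\<^sub>1] c objective_along_lifting[OF S, of d]
        objective_lower_bound liftings_in_assignment_manifold[OF S]
      unfolding D_def by blast
    have "c\<^sub>1 * \<bar>D 0\<bar> \<le> c\<^sub>2 * \<bar>D 0\<bar>"
      using c by (simp add: mult_right_mono)
    with t show ?thesis
      by (auto simp: armijo_def curvature_def liftings_0 S D_def simp flip: d_def
          intro!: exI[of _ t])
  next
    case True
    then have R: "replicator S (\<Omega> ** S) = 0"
      by (simp add: g_def grad_objective_def)
    have "(\<Omega> ** S) $ x $ j = S $ x \<bullet> (\<Omega> ** S) $ x" for x j
    proof -
      have "S $ x $ j * ((\<Omega> ** S) $ x $ j - S $ x \<bullet> (\<Omega> ** S) $ x) = 0"
        by (metis R replicator_component zero_index)
      then show ?thesis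
        using assignment_manifold_pos[OF S, of x j] by simp
    qed
    then have const: "(\<Omega> ** S) $ x = (S $ x \<bullet> (\<Omega> ** S) $ x) *\<^sub>R 1" for x
      by (simp add: vec_eq_iff)
    have "V - (1 \<bullet> V / real CARD('c)) *\<^sub>R 1 = 0" if "V = a *\<^sub>R 1" for a and V :: "real ^ 'c"
      using that by (simp add: inner_vec_def vec_eq_iff)
    then have "tangent_proj (\<Omega> ** S) = 0"
      using const by (auto simp: tangent_proj_def vec_eq_iff)
    moreover have "\<Omega> ** (0 :: real ^ 'c ^ 'n) = 0"
      by (simp add: vec_eq_iff matrix_mult_component)
    ultimately have "d = 0"
      by (simp add: d_def search_direction_def R)
    moreover have "D 0 = 0"
      using True D0 by (simp add: fisher_rao_def)
    ultimately show ?thesis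
      by (auto simp: armijo_def curvature_def liftings_0 S D_def simp flip: d_def
          intro!: exI[of _ 1])
  qed
qed

text \<open>The step size is chosen as a function of the current point; iterating this choice yields the
  points first and the sequence of step sizes afterwards.\<close>

lemma wolfe_iteration_exists:
  fixes S0 :: "real ^ 'c::finite ^ 'n"
  assumes S0: "S0 \<in> assignment_manifold" and h: "\<And>k. 0 \<le> h k \<and> h k \<le> 1"
    and c: "0 < c\<^sub>1" "c\<^sub>1 < c\<^sub>2" "c\<^sub>2 < 1"
  shows "\<exists>\<theta>. (\<forall>k. 0 < \<theta> k) \<and> wolfe_iteration \<Omega> h \<theta> c\<^sub>1 c\<^sub>2 S0"
proof -
  define P where "P = (\<lambda>k (S :: real ^ 'c ^ 'n) t. 0 < t \<and>
    (let d = search_direction \<Omega> S (h k); S' = liftings S (t *\<^sub>R d)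
     in armijo \<Omega> c\<^sub>1 t S d S' \<and> curvature \<Omega> c\<^sub>2 S d S'))"
  define step where "step = (\<lambda>k S. SOME t. P k S t)"
  have step: "P k S (step k S)" if "S \<in> assignment_manifold" for k and S :: "real ^ 'c ^ 'n"
    unfolding step_def
    by (rule someI_ex) (use wolfe_step_exists[OF that, of "h k" c\<^sub>1 c\<^sub>2] h c in
        \<open>auto simp: P_def Let_def\<close>)
  define X where
    "X = rec_nat S0 (\<lambda>k S. liftings S (step k S *\<^sub>R search_direction \<Omega> S (h k)))"
  have X_Suc: "X (Suc k) = liftings (X k) (step k (X k) *\<^sub>R search_direction \<Omega> (X k) (h k))" for k
    by (simp add: X_def)
  define \<theta> where "\<theta> k = step k (X k)" for k
  have X: "iterates \<Omega> h \<theta> S0 k = X k" for k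
  proof (induction k)
    case 0
    then show ?case by (simp add: X_def)
  next
    case (Suc k)
    then show ?case
      by (simp add: iterates_Suc_eq_liftings S0 X_Suc \<theta>_def del: iterates.simps)
  qed
  have "P k (X k) (\<theta> k)" for k
    unfolding \<theta>_def
    by (rule step) (metis X iterates_in_assignment_manifold[OF S0])
  then have "(\<forall>k. 0 < \<theta> k) \<and> wolfe_iteration \<Omega> h \<theta> c\<^sub>1 c\<^sub>2 S0"
    using c by (simp add: wolfe_iteration_def X X_Suc P_def Let_def flip: \<theta>_def del: iterates.simps)
  then show ?thesis by blast
qed

section \<open>Convergence of the gradients\<close>

text \<open>Eventually \<open>\<theta> k > \<gamma> / 2\<close>, and then Armijo and sufficient descent bound
  \<open>(c\<^sub>1 \<sigma> \<gamma> / 2) \<parallel>grad J\<parallel>\<^sup>2\<close> by the decrease of \<open>J\<close> in one step.  A decreasing sequence that is bounded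
  below converges, so these decreases tend to zero.\<close>

lemma gradient_tendsto_zero:
  fixes S0 :: "real ^ 'c::finite ^ 'n"
  assumes S0: "S0 \<in> assignment_manifold"
    and W: "wolfe_iteration \<Omega> h \<theta> c\<^sub>1 c\<^sub>2 S0"
    and sd: "sufficient_descent \<Omega> h \<theta> S0"
    and \<theta>: "\<theta> \<longlonglongrightarrow> \<gamma>" "0 < \<gamma>"
  shows "(\<lambda>k. grad_objective \<Omega> (iterates \<Omega> h \<theta> S0 k)) \<longlonglongrightarrow> 0"
proof -
  define S where "S = iterates \<Omega> h \<theta> S0"
  define g where "g k = grad_objective \<Omega> (S k)" for k
  define J where "J k = objective \<Omega> (S k)" for k
  have S: "S k \<in> assignment_manifold" for k
    by (simp add: S_def S0 iterates_in_assignment_manifold)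
  have c1: "0 < c\<^sub>1"
    using W by (simp add: wolfe_iteration_def)
  obtain \<sigma> where \<sigma>: "\<sigma> > 0" and ev: "\<forall>\<^sub>F k in sequentially.
      fisher_rao (S k) (g k) (replicator (S k) (search_direction \<Omega> (S k) (h k)))
        \<le> - \<sigma> * fisher_rao (S k) (g k) (g k)"
    using sd unfolding sufficient_descent_def Let_def S_def g_def by blast
  define \<kappa> where "\<kappa> = c\<^sub>1 * (\<gamma> / 2) * \<sigma>"
  have \<kappa>: "\<kappa> > 0"
    using c1 \<sigma> \<theta>(2) by (simp add: \<kappa>_def)
  have "\<forall>\<^sub>F k in sequentially. \<gamma> / 2 < \<theta> k"
    using \<theta> by (intro order_tendstoD) auto
  with ev have "\<forall>\<^sub>F k in sequentially. \<kappa> * (norm (g k))\<^sup>2 \<le> J k - J (Suc k)"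
  proof eventually_elim
    case (elim k)
    let ?s = "fisher_rao (S k) (g k) (replicator (S k) (search_direction \<Omega> (S k) (h k)))"
    have "\<sigma> * (norm (g k))\<^sup>2 \<le> \<sigma> * fisher_rao (S k) (g k) (g k)"
      using norm_le_fisher_rao[OF S[of k], of "g k"] \<sigma> by (simp add: power2_norm_eq_inner)
    then have s: "\<sigma> * (norm (g k))\<^sup>2 \<le> - ?s"
      using elim(1) by simp
    have "\<kappa> * (norm (g k))\<^sup>2 = c\<^sub>1 * (\<gamma> / 2) * (\<sigma> * (norm (g k))\<^sup>2)"
      by (simp add: \<kappa>_def)
    also have "\<dots> \<le> c\<^sub>1 * \<theta> k * (- ?s)"
      using elim(2) c1 \<sigma> \<theta>(2) s by (intro mult_mono) auto
    also have "\<dots> \<le> J k - J (Suc k)"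
      using W by (simp add: wolfe_iteration_def Let_def armijo_def J_def g_def S_def
          del: iterates.simps) (metis add.commute diff_le_eq minus_diff_eq neg_le_iff_le)
    finally show ?case .
  qed
  then obtain N where N: "\<And>k. k \<ge> N \<Longrightarrow> \<kappa> * (norm (g k))\<^sup>2 \<le> J k - J (Suc k)"
    by (auto simp: eventually_sequentially)
  have "J (Suc k) \<le> J k" if "k \<ge> N" for k
    using N[OF that] \<kappa> by (smt (verit) zero_le_mult_iff zero_le_power2)
  then have "decseq (\<lambda>k. J (k + N))"
    by (simp add: decseq_Suc_iff)
  moreover have "\<forall>k. - real CARD('n) / 2 \<le> J (k + N)"
    unfolding J_def using objective_lower_bound[OF S] by blast
  ultimately obtain L where "(\<lambda>k. J (k + N)) \<longlonglongrightarrow> L"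
    by (rule decseq_convergent)
  then have "J \<longlonglongrightarrow> L"
    by (rule LIMSEQ_offset)
  then have "(\<lambda>k. (J k - J (Suc k)) / \<kappa>) \<longlonglongrightarrow> (L - L) / \<kappa>"
    using \<kappa> by (intro tendsto_intros LIMSEQ_Suc) auto
  then have lim: "(\<lambda>k. (J k - J (Suc k)) / \<kappa>) \<longlonglongrightarrow> 0"
    by simp
  have "\<forall>\<^sub>F k in sequentially. (norm (g k))\<^sup>2 \<le> (J k - J (Suc k)) / \<kappa>"
    using N \<kappa> by (auto simp: eventually_sequentially le_divide_eq mult.commute)
  then have "(\<lambda>k. (norm (g k))\<^sup>2) \<longlonglongrightarrow> 0"
    by (intro tendsto_sandwich[OF _ _ tendsto_const lim]) simp_all
  then show ?thesis
    by (simp add: power_tendsto_0_iff tendsto_norm_zero_iff g_def S_def)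
qed

end

lemma continuous_grad_objective:
  "isCont (\<lambda>S :: real ^ 'c::finite ^ 'n::finite. grad_objective \<Omega> S) S"
proof -
  have "((\<lambda>S. (- replicator S (\<Omega> ** S)) $ x $ j) \<longlongrightarrow> (- replicator S (\<Omega> ** S)) $ x $ j) (at S)" for x j
    by (simp add: replicator_component inner_vec_def matrix_mult_component)
      (intro tendsto_intros)
  then show ?thesis
    by (simp add: isCont_def grad_objective_def vec_tendstoI)
qed

lemma limit_point_equilibrium:
  fixes S0 :: "real ^ 'c::finite ^ 'n"
  assumes S0: "S0 \<in> assignment_manifold"
    and grad: "(\<lambda>k. grad_objective \<Omega> (iterates \<Omega> h \<theta> S0 k)) \<longlonglongrightarrow> 0"
    and lim: "limit_point (iterates \<Omega> h \<theta> S0) S_lim"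
  shows "equilibrium \<Omega> S_lim"
proof -
  obtain r where r: "strict_mono r" and lim_r: "(iterates \<Omega> h \<theta> S0 \<circ> r) \<longlonglongrightarrow> S_lim"
    using lim unfolding limit_point_def by blast
  have "(\<lambda>k. grad_objective \<Omega> ((iterates \<Omega> h \<theta> S0 \<circ> r) k)) \<longlonglongrightarrow> grad_objective \<Omega> S_lim"
    using continuous_grad_objective lim_r by (rule isCont_tendsto_compose)
  moreover have "(\<lambda>k. grad_objective \<Omega> ((iterates \<Omega> h \<theta> S0 \<circ> r) k)) \<longlonglongrightarrow> 0"
    using LIMSEQ_subseq_LIMSEQ[OF grad r] by (simp add: comp_def)
  ultimately have "grad_objective \<Omega> S_lim = 0"
    by (rule LIMSEQ_unique)
  moreover have "S_lim \<in> closure assignment_manifold"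
    unfolding closure_sequential
    using lim_r iterates_in_assignment_manifold[OF S0] by (metis comp_apply)
  ultimately show ?thesis
    by (simp add: equilibrium_def grad_objective_def)
qed

section \<open>Local minimizers\<close>

context averaging_matrix
begin

text \<open>With \<open>i \<noteq> j\<close> let every row of \<open>V\<close> be \<open>e\<^sub>i - e\<^sub>j\<close>.  Unit row sums give \<open>\<Omega> V = V\<close>, so
  \<open>J (S + t V) = J S - t (V \<bullet> \<Omega> S) - (t\<^sup>2 / 2) \<parallel>V\<parallel>\<^sup>2\<close>, which is below \<open>J S\<close> whenever \<open>t \<noteq> 0\<close> and
  \<open>t (V \<bullet> \<Omega> S) \<ge> 0\<close>.  From an interior point, short steps along \<open>V\<close> in both directions stay in
  the manifold, so one of them contradicts minimality.\<close>

lemma local_minimizer_not_interior: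
  fixes S :: "real ^ 'c::finite ^ 'n"
  assumes card: "CARD('c) \<ge> 2" and lm: "local_minimizer \<Omega> S"
  shows "S \<notin> assignment_manifold"
proof
  assume S: "S \<in> assignment_manifold"
  obtain i j :: 'c where ij: "i \<noteq> j"
  proof -
    have "\<not> card (UNIV :: 'c set) \<le> Suc 0"
      using card by simp
    then show ?thesis
      using that by (auto simp: card_le_Suc0_iff_eq)
  qed
  define v :: "real ^ 'c" where "v = axis i 1 - axis j 1"
  define V :: "real ^ 'c ^ 'n" where "V = (\<chi> x. v)"
  have sum_v: "(\<Sum>k\<in>UNIV. v $ k) = 0"
    by (simp add: v_def axis_def sum_subtractf)
  have v_le: "\<bar>v $ k\<bar> \<le> 1" for k
    by (simp add: v_def axis_def)
  have "v $ i = 1"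
    using ij by (simp add: v_def axis_def)
  then have "V \<noteq> 0"
    by (auto simp: V_def vec_eq_iff intro!: exI[of _ i])
  have \<Omega>V: "\<Omega> ** V = V"
    by (simp add: vec_eq_iff matrix_mult_component V_def row_sum flip: sum_distrib_right)
  obtain e where "e > 0" and
    e: "\<And>T. T \<in> closure assignment_manifold \<Longrightarrow> dist T S < e \<Longrightarrow> objective \<Omega> S \<le> objective \<Omega> T"
    using lm unfolding local_minimizer_def by blast
  define m where "m = Min (range (\<lambda>(x, k). S $ x $ k))"
  have m: "0 < m" "m \<le> S $ x $ k" for x k
    by (auto simp: m_def assignment_manifold_pos[OF S] intro!: Min_le)
  define \<tau> where "\<tau> = min (m / 2) (e / (2 * norm V))"
  have \<tau>: "0 < \<tau>" "\<tau> < m" "\<tau> * norm V < e"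
  proof -
    show "0 < \<tau>" "\<tau> < m"
      using m(1) \<open>e > 0\<close> \<open>V \<noteq> 0\<close> by (auto simp: \<tau>_def)
    have "\<tau> * norm V \<le> e / (2 * norm V) * norm V"
      by (intro mult_right_mono) (auto simp: \<tau>_def)
    then show "\<tau> * norm V < e"
      using \<open>e > 0\<close> \<open>V \<noteq> 0\<close> by simp
  qed
  define t where "t = (if V \<bullet> (\<Omega> ** S) \<ge> 0 then \<tau> else - \<tau>)"
  have t: "\<bar>t\<bar> = \<tau>" "0 \<le> t * (V \<bullet> (\<Omega> ** S))"
    using \<tau>(1) by (auto simp: t_def mult_nonneg_nonpos)
  let ?T = "S + t *\<^sub>R V"
  have "0 < S $ x $ k + t * v $ k" for x k
  proof -
    have "\<bar>t * v $ k\<bar> \<le> \<tau>"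
      using v_le[of k] \<tau>(1) by (simp add: abs_mult t mult_left_le)
    then show ?thesis using m(2)[of x k] \<tau>(2) by linarith
  qed
  then have "?T \<in> assignment_manifold"
    using S by (simp add: assignment_manifold_iff V_def sum.distrib sum_v flip: sum_distrib_left)
  moreover have "dist ?T S < e"
    using \<tau>(3) by (simp add: dist_norm t)
  ultimately have "objective \<Omega> S \<le> objective \<Omega> ?T"
    using e closure_subset by blast
  moreover have "objective \<Omega> ?T = objective \<Omega> S - t * (V \<bullet> (\<Omega> ** S)) - t\<^sup>2 / 2 * (V \<bullet> V)"
    using inner_mult_symmetric[of S V]
    by (simp add: objective_def matrix_mult_add_scaleR \<Omega>V inner_add_left inner_add_right
        power2_eq_square algebra_simps)
  moreover have "0 < t\<^sup>2 / 2 * (V \<bullet> V)"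
    using t(1) \<tau>(1) \<open>V \<noteq> 0\<close> by auto
  ultimately show False
    using t(2) by linarith
qed

end

section \<open>Weights of the nonlocal model\<close>

lemma averaging_matrix_nonlocal_weights:
  fixes pos :: "'n::finite \<Rightarrow> 'v"
  assumes \<alpha>: "\<forall>x\<in>extended_vertices \<alpha> (range pos). \<forall>y\<in>extended_vertices \<alpha> (range pos).
      \<alpha> x y = - \<alpha> y x"
    and \<Theta>: "\<forall>x\<in>extended_vertices \<alpha> (range pos). \<forall>y\<in>extended_vertices \<alpha> (range pos).
      \<Theta> x y = \<Theta> y x \<and> 0 \<le> \<Theta> x y"
    and "\<forall>x. (\<Sum>y\<in>UNIV. nonlocal_weights pos \<Theta> \<alpha> $ x $ y) = 1"
  shows "averaging_matrix (nonlocal_weights pos \<Theta> \<alpha>)"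
proof
  have pos: "pos i \<in> extended_vertices \<alpha> (range pos)" for i
    by (simp add: extended_vertices_def)
  show "nonlocal_weights pos \<Theta> \<alpha> $ x $ y = nonlocal_weights pos \<Theta> \<alpha> $ y $ x" for x y
  proof -
    have "(\<alpha> (pos x) (pos y))\<^sup>2 = (\<alpha> (pos y) (pos x))\<^sup>2"
      using \<alpha> pos by (metis power2_minus)
    then show ?thesis
      using \<Theta> pos by (simp add: nonlocal_weights_def)
  qed
  show "0 \<le> nonlocal_weights pos \<Theta> \<alpha> $ x $ y" for x y
    using \<Theta> pos by (simp add: nonlocal_weights_def)
qed (use assms(3) in blast)

theorem proposition5p3:
  fixes pos :: "'n::finite \<Rightarrow> int ^ 'd::finite"
    and \<Theta> \<alpha> :: "int ^ 'd \<Rightarrow> int ^ 'd \<Rightarrow> real"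
    and \<Omega> :: "real ^ 'n ^ 'n"
    and S0 :: "real ^ 'c::finite ^ 'n"
  assumes "CARD('d) \<ge> 2" and "CARD('c) \<ge> 2" and "inj pos"
    and "finite (extended_vertices \<alpha> (range pos))"
    and "\<forall>x\<in>extended_vertices \<alpha> (range pos). \<forall>y\<in>extended_vertices \<alpha> (range pos).
           \<alpha> x y = - \<alpha> y x"
    and "\<forall>x\<in>interaction_domain \<alpha> (range pos). \<forall>y\<in>interaction_domain \<alpha> (range pos).
           \<alpha> x y = 0"
    and "\<forall>x\<in>extended_vertices \<alpha> (range pos). \<forall>y\<in>extended_vertices \<alpha> (range pos).
           \<Theta> x y = \<Theta> y x \<and> 0 \<le> \<Theta> x y"
    and "\<Omega> = nonlocal_weights pos \<Theta> \<alpha>"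
    and "\<forall>x y. 0 \<le> \<Omega> $ x $ y \<and> \<Omega> $ x $ y \<le> 1"
    and "\<forall>x. (\<Sum>y\<in>UNIV. \<Omega> $ x $ y) = 1"
    and "S0 \<in> assignment_manifold"
  shows
    "(\<exists>h \<theta> c\<^sub>1 c\<^sub>2.
        (\<forall>k. 0 < h k \<and> 0 < \<theta> k) \<and>
        wolfe_iteration \<Omega> h \<theta> c\<^sub>1 c\<^sub>2 S0 \<and>
        sufficient_descent \<Omega> h \<theta> S0 \<and>
        (\<forall>k. let S = iterates \<Omega> h \<theta> S0 k; d = search_direction \<Omega> S (h k)
             in S \<in> assignment_manifold \<and> d \<in> tangent_space \<and>
                iterates \<Omega> h \<theta> S0 (Suc k) = liftings S (\<theta> k *\<^sub>R d)))
     \<and>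
     (\<forall>h \<theta> c\<^sub>1 c\<^sub>2 \<gamma> S_lim.
        (\<forall>k. 0 \<le> h k \<and> 0 \<le> \<theta> k) \<and> wolfe_iteration \<Omega> h \<theta> c\<^sub>1 c\<^sub>2 S0 \<and>
        sufficient_descent \<Omega> h \<theta> S0 \<and>
        \<theta> \<longlonglongrightarrow> \<gamma> \<and> 0 < \<gamma> \<and>
        limit_point (iterates \<Omega> h \<theta> S0) S_lim
        \<longrightarrow> equilibrium \<Omega> S_lim)
     \<and>
     (\<forall>h \<theta> c\<^sub>1 c\<^sub>2 \<gamma> S_lim.
        (\<forall>k. 0 \<le> h k \<and> 0 \<le> \<theta> k) \<and> wolfe_iteration \<Omega> h \<theta> c\<^sub>1 c\<^sub>2 S0 \<and>
        \<theta> \<longlonglongrightarrow> \<gamma> \<and> 0 < \<gamma> \<and>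
        limit_point (iterates \<Omega> h \<theta> S0) S_lim \<and> local_minimizer \<Omega> S_lim
        \<longrightarrow> S_lim \<in> closure assignment_manifold - assignment_manifold)
     \<and>
     (\<forall>h \<theta> c\<^sub>1 c\<^sub>2 \<gamma>.
        (\<forall>k. 0 \<le> h k \<and> 0 \<le> \<theta> k) \<and> wolfe_iteration \<Omega> h \<theta> c\<^sub>1 c\<^sub>2 S0 \<and>
        \<theta> \<longlonglongrightarrow> \<gamma> \<and> 0 < \<gamma> \<and> summable h
        \<longrightarrow> (\<lambda>k. norm (grad_objective \<Omega> (iterates \<Omega> h \<theta> S0 k))) \<longlonglongrightarrow> 0)"
proof -
  \<comment> \<open>Antisymmetric \<open>\<alpha>\<close> enters squared, hence \<open>\<Omega>\<close> is symmetric.\<close>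
  interpret averaging_matrix \<Omega>
    unfolding assms(8)
    by (rule averaging_matrix_nonlocal_weights[OF assms(5,7)]) (use assms(8,10) in blast)
  note S0 = assms(11)
  have i: "\<exists>h \<theta> c\<^sub>1 c\<^sub>2.
        (\<forall>k. 0 < h k \<and> 0 < \<theta> k) \<and>
        wolfe_iteration \<Omega> h \<theta> c\<^sub>1 c\<^sub>2 S0 \<and>
        sufficient_descent \<Omega> h \<theta> S0 \<and>
        (\<forall>k. let S = iterates \<Omega> h \<theta> S0 k; d = search_direction \<Omega> S (h k)
             in S \<in> assignment_manifold \<and> d \<in> tangent_space \<and>
                iterates \<Omega> h \<theta> S0 (Suc k) = liftings S (\<theta> k *\<^sub>R d))"
  proof -
    \<comment> \<open>\<open>h = 1\<close> is small enough for descent at every point; any \<open>0 < c\<^sub>1 < c\<^sub>2 < 1\<close> would do.\<close>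
    obtain \<theta> where \<theta>: "\<forall>k. 0 < \<theta> k" "wolfe_iteration \<Omega> (\<lambda>_. 1) \<theta> (1/4) (1/2) S0"
      using wolfe_iteration_exists[OF S0, of "\<lambda>_. 1" "1/4" "1/2"] by auto
    moreover have "sufficient_descent \<Omega> (\<lambda>_. 1) \<theta> S0"
      by (rule sufficient_descent_if_small[OF S0]) simp
    moreover have "search_direction \<Omega> S h \<in> tangent_space" for S :: "real ^ 'c ^ 'n" and h
      by (simp add: search_direction_def tangent_proj_in_tangent_space)
    ultimately show ?thesis
      using iterates_in_assignment_manifold[OF S0] iterates_Suc_eq_liftings[OF S0]
      unfolding Let_def
      by (intro exI[of _ "\<lambda>_. 1"] exI[of _ \<theta>] exI[of _ "1/4"] exI[of _ "1/2"])
        (simp del: iterates.simps)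
  qed
  have ii: "equilibrium \<Omega> S_lim"
    if "wolfe_iteration \<Omega> h \<theta> c\<^sub>1 c\<^sub>2 S0" "sufficient_descent \<Omega> h \<theta> S0"
      "\<theta> \<longlonglongrightarrow> \<gamma>" "0 < \<gamma>" "limit_point (iterates \<Omega> h \<theta> S0) S_lim"
    for h \<theta> c\<^sub>1 c\<^sub>2 \<gamma> S_lim
    using limit_point_equilibrium[OF S0 gradient_tendsto_zero[OF S0 that(1-4)] that(5)] .
  have iii: "S_lim \<in> closure assignment_manifold - assignment_manifold"
    if "local_minimizer \<Omega> S_lim" for S_lim :: "real ^ 'c ^ 'n"
    using local_minimizer_not_interior[OF assms(2) that] that
    by (simp add: local_minimizer_def)
  have iv: "(\<lambda>k. norm (grad_objective \<Omega> (iterates \<Omega> h \<theta> S0 k))) \<longlonglongrightarrow> 0"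
    if "\<forall>k. 0 \<le> h k \<and> 0 \<le> \<theta> k" "wolfe_iteration \<Omega> h \<theta> c\<^sub>1 c\<^sub>2 S0"
      "\<theta> \<longlonglongrightarrow> \<gamma>" "0 < \<gamma>" "summable h"
    for h \<theta> c\<^sub>1 c\<^sub>2 \<gamma>
  proof -
    have "\<forall>\<^sub>F k in sequentially. h k < 1"
      using summable_LIMSEQ_zero[OF that(5)] by (rule order_tendstoD) simp
    then have "\<forall>\<^sub>F k in sequentially. 0 \<le> h k \<and> h k \<le> 1"
      by (rule eventually_mono) (use that(1) in auto)
    then have "sufficient_descent \<Omega> h \<theta> S0"
      by (rule sufficient_descent_if_small[OF S0])
    then show ?thesis
      using gradient_tendsto_zero[OF S0 that(2) _ that(3,4)] by (simp add: tendsto_norm_zero)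
  qed
  show ?thesis
    by (intro conjI allI impI i) (use ii iii iv in blast)+
qed

end
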